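(* Let $G=(U\cup V,E)$ be a finite bipartite graph with parts $U$ and $V$. Then $G$ is an intersection of three chain graphs on the vertex set $U\cup V$ (i.e. $G$ has Ferrers dimension at most three) if and only if there exist a linear ordering of $U$ and a linear ordering of $V$ such that the resulting biadjacency matrix $A$ of $G$ (rows indexed by $U$, columns indexed by $V$, in these orders; $A[u,v]=1$ if $\{u,v\}\in E$ and $0$ otherwise) contains neither of the patterns $$\Gamma=\begin{pmatrix} * & 1 & * \\ 1 & 0 & 1 \\ 0 & 1 & * \end{pmatrix}\qquad\text{and}\qquad \Delta=\begin{pmatrix} 1 & * & * \\ 0 & 1 & * \\ 1 & 0 & 1 \end{pmatrix}.$$
   Context: A bipartite graph $H=(U\cup V,E)$ is a chain graph if $U$ and $V$ can be linearly ordered as $u_1,\dots,u_{|U|}$ and $v_1,\dots,v_{|V|}$ so that $N(u_1)\subseteq N(u_2)\subseteq\cdots\subseteq N(u_{|U|})$ and $N(v_1)\subseteq\cdots\subseteq N(v_{|V|})$. For graphs $G_1=(W,E_1)$, $G_2=(W,E_2)$ on the same vertex set, $G_1\cap G_2=(W,E_1\cap E_2)$. The Ferrers dimension of a bipartite graph $G$ is the minimum $d$ such that $G=G_1\cap\cdots\cap G_d$ for some chain graphs $G_1,\dots,G_d$ on the same vertex set with the same bipartition. A pattern is a matrix $P$ with entries in $\{0,1,*\}$. A $0/1$ matrix $M'$ of the same size matches $P$ if $M'[i,j]=P[i,j]$ for every entry with $P[i,j]\neq *$ (a $*$ allows either $0$ or $1$). A $0/1$ matrix $M$ contains $P$ if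 some submatrix of $M$ (obtained by choosing a set of rows and a set of columns, keeping their relative order) matches $P$; otherwise $M$ is $P$-free. *)

theory Defs
  imports
    "HOL-Combinatorics.Multiset_Permutations"
    "Jordan_Normal_Form.DL_Submatrix"
begin

text \<open>
  Finite simple bipartite graphs with a fixed bipartition are given by their two parts
  \<open>U\<close>, \<open>V\<close> and their set \<open>E\<close> of edges, an edge being an unordered pair \<open>{u, v}\<close>.
  Hence the intersection of graphs with the same vertex set and the same bipartition is given
  by the intersection of their edge sets.

  A linear ordering of a finite set \<open>S\<close> is a duplicate-free list of all elements
  of \<open>S\<close>, that is, an element of \<open>permutations_of_set S\<close>.
\<close>

definition bipartite_graph :: "'a set \<Rightarrow> 'a set \<Rightarrow> 'a set set \<Rightarrow> bool" where
  "bipartite_graph U V E \<longleftrightarrow>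
     finite U \<and> finite V \<and> U \<inter> V = {} \<and> (\<forall>e\<in>E. \<exists>u\<in>U. \<exists>v\<in>V. e = {u, v})"

definition neighbourhood :: "'a set set \<Rightarrow> 'a \<Rightarrow> 'a set" where
  "neighbourhood E x = {y. {x, y} \<in> E}"

definition chain_graph :: "'a set \<Rightarrow> 'a set \<Rightarrow> 'a set set \<Rightarrow> bool" where
  "chain_graph U V E \<longleftrightarrow>
     bipartite_graph U V E \<and>
     (\<exists>us \<in> permutations_of_set U. \<forall>i j. i \<le> j \<longrightarrow> j < length us \<longrightarrow>
        neighbourhood E (us ! i) \<subseteq> neighbourhood E (us ! j)) \<and>
     (\<exists>vs \<in> permutations_of_set V. \<forall>i j. i \<le> j \<longrightarrow> j < length vs \<longrightarrow>
        neighbourhood E (vs ! i) \<subseteq> neighbourhood E (vs ! j))"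

definition ferrers_dimension :: "'a set \<Rightarrow> 'a set \<Rightarrow> 'a set set \<Rightarrow> nat" where
  "ferrers_dimension U V E =
     (LEAST d. d \<ge> 1 \<and>
        (\<exists>F :: nat \<Rightarrow> 'a set set. (\<forall>i<d. chain_graph U V (F i)) \<and> E = (\<Inter>i<d. F i)))"

definition biadjacency_matrix :: "'a set set \<Rightarrow> 'a list \<Rightarrow> 'a list \<Rightarrow> nat mat" where
  "biadjacency_matrix E us vs =
     mat (length us) (length vs) (\<lambda>(i, j). if {us ! i, vs ! j} \<in> E then 1 else 0)"

text \<open>
  Patterns are matrices over \<open>nat option\<close> with entries \<open>Some 0\<close>, \<open>Some 1\<close>,
  and \<open>None\<close> for the wildcard.
\<close>

definition matches_pattern :: "nat mat \<Rightarrow> nat option mat \<Rightarrow> bool" where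
  "matches_pattern M P \<longleftrightarrow>
     dim_row M = dim_row P \<and> dim_col M = dim_col P \<and>
     (\<forall>i<dim_row P. \<forall>j<dim_col P. P $$ (i, j) \<noteq> None \<longrightarrow> P $$ (i, j) = Some (M $$ (i, j)))"

definition contains_pattern :: "nat mat \<Rightarrow> nat option mat \<Rightarrow> bool" where
  "contains_pattern M P \<longleftrightarrow>
     (\<exists>I J. I \<subseteq> {..<dim_row M} \<and> J \<subseteq> {..<dim_col M} \<and> matches_pattern (submatrix M I J) P)"

definition Gamma_pattern :: "nat option mat" where
  "Gamma_pattern = mat_of_rows_list 3
     [[None,   Some 1, None  ],
      [Some 1, Some 0, Some 1],
      [Some 0, Some 1, None  ]]"

definition Delta_pattern :: "nat option mat" where
  "Delta_pattern = mat_of_rows_list 3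
     [[Some 1, None,   None  ],
      [Some 0, Some 1, None  ],
      [Some 1, Some 0, Some 1]]"

end

theory Submission
  imports Defs
begin

text \<open>
  Suppose \<open>E\<close> is an intersection of three chain graphs. Order the rows by the first one and the
  columns by the second one, so that the non-edges of the first propagate upwards and those of the
  second to the right. A zero with a one above it and a one to its right, called
  \<^emph>\<open>forced\<close>, is then a non-edge of the third. A chain graph has no induced \<open>2K\<^sub>2\<close>, so two forced
  zeros \<open>(i, j)\<close>, \<open>(i', j')\<close> cannot conflict, i.e. have ones at \<open>(i, j')\<close> and \<open>(i', j)\<close>;
  the two patterns are the two shapes of such a conflict.

  Conversely, the zeros without a one above them are the non-edges of a chain graph, and likewise
  the zeros without a one to their right. A third chain graph containing \<open>E\<close> can omit all forced
  zeros iff the following relation on rows is acyclic: \<open>i'\<close> precedes \<open>i\<close> if, for some \<open>j\<close>,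
  \<open>(i', j)\<close> is a forced zero and \<open>(i, j)\<close> is a one. A conflict is a cycle of length two, and in a
  longer cycle the topmost row can be bypassed, so without conflicts there is no cycle at all.
\<close>

subsection \<open>Pattern containment\<close>

text \<open>Exactly \<open>i\<close> elements of the image lie below \<open>f i\<close>, namely the
  values at smaller arguments, and \<open>pick\<close> enumerates a set of naturals in increasing
  order.\<close>

lemma pick_image_strict_mono_on:
  assumes "strict_mono_on {..<n} f" and "i < n"
  shows "pick (f ` {..<n}) i = f i"
proof -
  have "{a \<in> f ` {..<n}. a < f i} = f ` {..<i}"
    using assms by (auto simp: strict_mono_on_less)
  moreover have "inj_on f {..<i}"
    using assms by (intro inj_on_subset[OF strict_mono_on_imp_inj_on]) auto
  ultimately have "card {a \<in> f ` {..<n}. a < f i} = i"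
    by (simp add: card_image)
  then show ?thesis
    using pick_card_in_set[of "f i" "f ` {..<n}"] assms(2) by auto
qed

text \<open>A choice of index sets amounts to a pair of increasing index maps: \<open>pick\<close>
  enumerates the chosen sets in one direction, and the ranges of the maps serve as the sets in the
  other.\<close>

lemma contains_pattern_iff:
  "contains_pattern M P \<longleftrightarrow>
     (\<exists>f g. strict_mono_on {..<dim_row P} f \<and> f ` {..<dim_row P} \<subseteq> {..<dim_row M} \<and>
        strict_mono_on {..<dim_col P} g \<and> g ` {..<dim_col P} \<subseteq> {..<dim_col M} \<and>
        (\<forall>i<dim_row P. \<forall>j<dim_col P. P $$ (i, j) \<noteq> None \<longrightarrow>
           P $$ (i, j) = Some (M $$ (f i, g j))))" (is "?L \<longleftrightarrow> ?R")
proof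
  assume ?L
  then obtain I J where m: "matches_pattern (submatrix M I J) P"
    unfolding contains_pattern_def by blast
  let ?I = "{i. i < dim_row M \<and> i \<in> I}" and ?J = "{j. j < dim_col M \<and> j \<in> J}"
  have dims: "dim_row P = card ?I" "dim_col P = card ?J"
    using m by (simp_all add: matches_pattern_def dim_submatrix)
  \<comment> \<open>Monotonicity of \<open>pick\<close> is applied to the part of \<open>K\<close>
    below \<open>n\<close>, which is what \<open>submatrix\<close> sees;
    \<open>pick_reduce_set\<close> identifies the two enumerations at these indices.\<close>
  have "strict_mono_on {..<card {a. a < n \<and> a \<in> K}} (pick K)" for n K
  proof (rule strict_mono_onI)
    fix x y assume "x \<in> {..<card {a. a < n \<and> a \<in> K}}" "y \<in> {..<card {a. a < n \<and> a \<in> K}}" "x < y"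
    then show "pick K x < pick K y"
      using pick_mono_le[of y "{a. a < n \<and> a \<in> K}" x] pick_reduce_set[of x n K] pick_reduce_set[of y n K]
      by simp
  qed
  then have "strict_mono_on {..<card ?I} (pick I)" "strict_mono_on {..<card ?J} (pick J)"
    by blast+
  moreover have "pick I ` {..<card ?I} \<subseteq> {..<dim_row M}" "pick J ` {..<card ?J} \<subseteq> {..<dim_col M}"
    using pick_le[of _ "dim_row M" I] pick_le[of _ "dim_col M" J] by auto
  moreover have "\<forall>i<dim_row P. \<forall>j<dim_col P. P $$ (i, j) \<noteq> None \<longrightarrow>
           P $$ (i, j) = Some (M $$ (pick I i, pick J j))"
    using m by (auto simp: matches_pattern_def dims submatrix_index)
  ultimately show ?R
    unfolding dims by blast
next
  assume ?R
  then obtain f g where f: "strict_mono_on {..<dim_row P} f" "f ` {..<dim_row P} \<subseteq> {..<dim_row M}"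
    and g: "strict_mono_on {..<dim_col P} g" "g ` {..<dim_col P} \<subseteq> {..<dim_col M}"
    and P: "\<And>i j. i < dim_row P \<Longrightarrow> j < dim_col P \<Longrightarrow> P $$ (i, j) \<noteq> None \<Longrightarrow>
           P $$ (i, j) = Some (M $$ (f i, g j))"
    by (elim exE conjE) simp
  let ?I = "f ` {..<dim_row P}" and ?J = "g ` {..<dim_col P}"
  have "{i. i < dim_row M \<and> i \<in> ?I} = ?I" "{j. j < dim_col M \<and> j \<in> ?J} = ?J"
    using f(2) g(2) by auto
  then have cards: "card {i. i < dim_row M \<and> i \<in> ?I} = dim_row P"
    "card {j. j < dim_col M \<and> j \<in> ?J} = dim_col P"
    using f(1) g(1) by (simp_all only: card_image strict_mono_on_imp_inj_on card_lessThan)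
  have "matches_pattern (submatrix M ?I ?J) P"
    unfolding matches_pattern_def dim_submatrix cards
  proof (intro conjI allI impI refl)
    fix i j assume ij: "i < dim_row P" "j < dim_col P" and "P $$ (i, j) \<noteq> None"
    then have "P $$ (i, j) = Some (M $$ (f i, g j))" by (rule P)
    also have "M $$ (f i, g j) = submatrix M ?I ?J $$ (i, j)"
      using ij by (simp only: submatrix_index cards pick_image_strict_mono_on[OF f(1)]
          pick_image_strict_mono_on[OF g(1)])
    finally show "P $$ (i, j) = Some (submatrix M ?I ?J $$ (i, j))" .
  qed
  then show ?L
    unfolding contains_pattern_def using f(2) g(2) by blast
qed

lemma strict_mono_on_three:
  fixes f :: "nat \<Rightarrow> nat"
  shows "strict_mono_on {..<3::nat} f \<longleftrightarrow> f 0 < f 1 \<and> f 1 < f 2"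
  by (auto simp: strict_mono_on_def numeral_3_eq_3 numeral_2_eq_2 less_Suc_eq)

lemma All_less_three: "(\<forall>i<3::nat. Q i) \<longleftrightarrow> Q 0 \<and> Q 1 \<and> Q 2"
  by (auto simp: numeral_3_eq_3 numeral_2_eq_2 less_Suc_eq)

lemma contains_three_pattern_iff:
  assumes "dim_row P = 3" "dim_col P = 3"
  shows "contains_pattern M P \<longleftrightarrow>
     (\<exists>(f :: nat \<Rightarrow> nat) (g :: nat \<Rightarrow> nat).
        f 0 < f 1 \<and> f 1 < f 2 \<and> f 2 < dim_row M \<and>
        g 0 < g 1 \<and> g 1 < g 2 \<and> g 2 < dim_col M \<and>
        (\<forall>i<3. \<forall>j<3. P $$ (i, j) \<noteq> None \<longrightarrow> P $$ (i, j) = Some (M $$ (f i, g j))))"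
proof -
  have "strict_mono_on {..<3} f \<and> f ` {..<3} \<subseteq> {..<n} \<longleftrightarrow> f 0 < f 1 \<and> f 1 < f 2 \<and> f 2 < n"
    for f :: "nat \<Rightarrow> nat" and n
    using All_less_three[of "\<lambda>i. f i < n"] by (auto simp: strict_mono_on_three image_subset_iff)
  then show ?thesis
    unfolding contains_pattern_iff assms by (simp only: conj_assoc[symmetric])
qed

lemma contains_Gamma_iff:
  "contains_pattern M Gamma_pattern \<longleftrightarrow>
     (\<exists>a b c a' b' c'. a < b \<and> b < c \<and> c < dim_row M \<and> a' < b' \<and> b' < c' \<and> c' < dim_col M \<and>
        M $$ (a, b') = 1 \<and> M $$ (b, a') = 1 \<and> M $$ (b, b') = 0 \<and> M $$ (b, c') = 1 \<and>
        M $$ (c, a') = 0 \<and> M $$ (c, b') = 1)" (is "_ \<longleftrightarrow> ?R")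
proof -
  have "contains_pattern M Gamma_pattern \<longleftrightarrow>
     (\<exists>(f :: nat \<Rightarrow> nat) (g :: nat \<Rightarrow> nat).
        f 0 < f 1 \<and> f 1 < f 2 \<and> f 2 < dim_row M \<and>
        g 0 < g 1 \<and> g 1 < g 2 \<and> g 2 < dim_col M \<and>
        M $$ (f 0, g 1) = 1 \<and> M $$ (f 1, g 0) = 1 \<and> M $$ (f 1, g 1) = 0 \<and> M $$ (f 1, g 2) = 1 \<and>
        M $$ (f 2, g 0) = 0 \<and> M $$ (f 2, g 1) = 1)" (is "_ \<longleftrightarrow> ?S")
    by (subst contains_three_pattern_iff)
      (simp_all add: Gamma_pattern_def mat_of_rows_list_def All_less_three del: One_nat_def)
  also have "?S \<longleftrightarrow> ?R"
  proof
    assume ?R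
    then obtain a b c a' b' c' where "a < b" "b < c" "c < dim_row M" "a' < b'" "b' < c'" "c' < dim_col M"
        "M $$ (a, b') = 1" "M $$ (b, a') = 1" "M $$ (b, b') = 0" "M $$ (b, c') = 1"
        "M $$ (c, a') = 0" "M $$ (c, b') = 1" by blast
    \<comment> \<open>Three indices become an index map by list lookup; only its values at 0, 1 and
      2 matter.\<close>
    then show ?S by (intro exI[of _ "(!) [a, b, c]"] exI[of _ "(!) [a', b', c']"]) simp
  qed blast
  finally show ?thesis .
qed

lemma contains_Delta_iff:
  "contains_pattern M Delta_pattern \<longleftrightarrow>
     (\<exists>a b c a' b' c'. a < b \<and> b < c \<and> c < dim_row M \<and> a' < b' \<and> b' < c' \<and> c' < dim_col M \<and>
        M $$ (a, a') = 1 \<and> M $$ (b, a') = 0 \<and> M $$ (b, b') = 1 \<and>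
        M $$ (c, a') = 1 \<and> M $$ (c, b') = 0 \<and> M $$ (c, c') = 1)" (is "_ \<longleftrightarrow> ?R")
proof -
  have "contains_pattern M Delta_pattern \<longleftrightarrow>
     (\<exists>(f :: nat \<Rightarrow> nat) (g :: nat \<Rightarrow> nat).
        f 0 < f 1 \<and> f 1 < f 2 \<and> f 2 < dim_row M \<and>
        g 0 < g 1 \<and> g 1 < g 2 \<and> g 2 < dim_col M \<and>
        M $$ (f 0, g 0) = 1 \<and> M $$ (f 1, g 0) = 0 \<and> M $$ (f 1, g 1) = 1 \<and>
        M $$ (f 2, g 0) = 1 \<and> M $$ (f 2, g 1) = 0 \<and> M $$ (f 2, g 2) = 1)" (is "_ \<longleftrightarrow> ?S")
    by (subst contains_three_pattern_iff)
      (simp_all add: Delta_pattern_def mat_of_rows_list_def All_less_three del: One_nat_def)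
  also have "?S \<longleftrightarrow> ?R"
  proof
    assume ?R
    then obtain a b c a' b' c' where "a < b" "b < c" "c < dim_row M" "a' < b'" "b' < c'" "c' < dim_col M"
        "M $$ (a, a') = 1" "M $$ (b, a') = 0" "M $$ (b, b') = 1"
        "M $$ (c, a') = 1" "M $$ (c, b') = 0" "M $$ (c, c') = 1" by blast
    then show ?S by (intro exI[of _ "(!) [a, b, c]"] exI[of _ "(!) [a', b', c']"]) simp
  qed blast
  finally show ?thesis .
qed

subsection \<open>Forced zeros\<close>

definition forced_zero :: "(nat \<Rightarrow> nat \<Rightarrow> bool) \<Rightarrow> nat \<Rightarrow> nat \<Rightarrow> bool" where
  "forced_zero A i j \<longleftrightarrow> \<not> A i j \<and> (\<exists>i'<i. A i' j) \<and> (\<exists>j'>j. A i j')"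

definition conflict_free :: "(nat \<Rightarrow> nat \<Rightarrow> bool) \<Rightarrow> bool" where
  "conflict_free A \<longleftrightarrow>
     \<not> (\<exists>i j i' j'. forced_zero A i j \<and> forced_zero A i' j' \<and> A i j' \<and> A i' j)"

text \<open>The matrix is padded with zeros outside its range. A forced zero shares its row and its
  column with ones, so padding creates none and index bounds can be left implicit.\<close>

definition bip_entry :: "'a set set \<Rightarrow> 'a list \<Rightarrow> 'a list \<Rightarrow> nat \<Rightarrow> nat \<Rightarrow> bool" where
  "bip_entry E us vs i j \<longleftrightarrow> i < length us \<and> j < length vs \<and> {us ! i, vs ! j} \<in> E"

text \<open>The two rows of a conflict differ, and so do its two columns. With the rows in
  increasing order, the order of the columns decides which pattern appears. Conversely, two zeros of
  each pattern are forced and conflict.\<close>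

lemma conflict_free_iff:
  "conflict_free A \<longleftrightarrow>
     \<not> (\<exists>a b c a' b' c'. a < b \<and> b < c \<and> a' < b' \<and> b' < c' \<and>
        A a b' \<and> A b a' \<and> \<not> A b b' \<and> A b c' \<and> \<not> A c a' \<and> A c b') \<and>
     \<not> (\<exists>a b c a' b' c'. a < b \<and> b < c \<and> a' < b' \<and> b' < c' \<and>
        A a a' \<and> \<not> A b a' \<and> A b b' \<and> A c a' \<and> \<not> A c b' \<and> A c c')"
    (is "_ \<longleftrightarrow> \<not> ?G \<and> \<not> ?D")
proof -
  define G D where "G = ?G" and "D = ?D"
  have GD: "G \<or> D" if F: "forced_zero A i j" "forced_zero A i' j'" and A: "A i j'" "A i' j"
    and lt: "i < i'" for i j i' j'
  proof -
    obtain a c' where w: "a < i" "A a j" "c' > j'" "A i' c'"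
      using F by (auto simp: forced_zero_def)
    obtain d' where d: "d' > j" "A i d'"
      using F by (auto simp: forced_zero_def)
    have z: "\<not> A i j" "\<not> A i' j'" using F by (auto simp: forced_zero_def)
    then have "j \<noteq> j'" using A by auto
    then consider "j < j'" | "j' < j" by linarith
    then show ?thesis
    proof cases
      \<comment> \<open>The one at \<open>(i, j')\<close> is both to the right of the first zero and
        above the second, so \<open>Delta_pattern\<close> only needs a one above the first and a one
        to the right of the second.\<close>
      case 1
      have D
        unfolding D_def
        by (rule exI[of _ a], rule exI[of _ i], rule exI[of _ i'], rule exI[of _ j],
            rule exI[of _ j'], rule exI[of _ c'], intro conjI; fact)
      then show ?thesis ..
    next
      \<comment> \<open>Here the second zero has the conflict's own ones above it and to its right,
        so \<open>Gamma_pattern\<close> takes both further ones from the first zero.\<close>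
      case 2
      have G
        unfolding G_def
        by (rule exI[of _ a], rule exI[of _ i], rule exI[of _ i'], rule exI[of _ j'],
            rule exI[of _ j], rule exI[of _ d'], intro conjI; fact)
      then show ?thesis ..
    qed
  qed
  have "\<not> conflict_free A \<longleftrightarrow> G \<or> D"
  proof
    assume "\<not> conflict_free A"
    then obtain i j i' j' where *: "forced_zero A i j" "forced_zero A i' j'" "A i j'" "A i' j"
      by (auto simp: conflict_free_def)
    then have "i \<noteq> i'" by (auto simp: forced_zero_def)
    then consider "i < i'" | "i' < i" by linarith
    then show "G \<or> D"
      by cases (use GD[OF *(1,2,3,4)] GD[OF *(2,1,4,3)] in blast)+
  next
    assume "G \<or> D"
    then show "\<not> conflict_free A"
    proof
      assume G
      then obtain a b c a' b' c' where *: "a < b" "b < c" "a' < b'" "b' < c'"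
        "A a b'" "A b a'" "\<not> A b b'" "A b c'" "\<not> A c a'" "A c b'"
        unfolding G_def by blast
      then have "forced_zero A b b'" "forced_zero A c a'" by (auto simp: forced_zero_def)
      with * show ?thesis unfolding conflict_free_def by blast
    next
      assume D
      then obtain a b c a' b' c' where *: "a < b" "b < c" "a' < b'" "b' < c'"
        "A a a'" "\<not> A b a'" "A b b'" "A c a'" "\<not> A c b'" "A c c'"
        unfolding D_def by blast
      then have "forced_zero A b a'" "forced_zero A c b'" by (auto simp: forced_zero_def)
      with * show ?thesis unfolding conflict_free_def by blast
    qed
  qed
  then have "conflict_free A \<longleftrightarrow> \<not> G \<and> \<not> D" by blast
  then show ?thesis unfolding G_def D_def .
qed

lemma biadjacency_matrix_index:
  assumes "i < length us" "j < length vs"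
  shows "biadjacency_matrix E us vs $$ (i, j) = 1 \<longleftrightarrow> bip_entry E us vs i j"
    and "biadjacency_matrix E us vs $$ (i, j) = 0 \<longleftrightarrow> \<not> bip_entry E us vs i j"
  using assms by (auto simp: biadjacency_matrix_def bip_entry_def)

text \<open>Every row and every column of either pattern contains a one, so the range conditions on
  the indices follow from the entries.\<close>

lemma avoids_patterns_iff_conflict_free:
  "\<not> contains_pattern (biadjacency_matrix E us vs) Gamma_pattern \<and>
   \<not> contains_pattern (biadjacency_matrix E us vs) Delta_pattern \<longleftrightarrow>
   conflict_free (bip_entry E us vs)"
proof -
  let ?A = "bip_entry E us vs" and ?M = "biadjacency_matrix E us vs"
  have dims: "dim_row ?M = length us" "dim_col ?M = length vs"
    by (simp_all add: biadjacency_matrix_def)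
  have bound: "i < length us" "j < length vs" if "?A i j" for i j
    using that by (auto simp: bip_entry_def)
  have G: "contains_pattern ?M Gamma_pattern \<longleftrightarrow>
     (\<exists>a b c a' b' c'. a < b \<and> b < c \<and> a' < b' \<and> b' < c' \<and>
        ?A a b' \<and> ?A b a' \<and> \<not> ?A b b' \<and> ?A b c' \<and> \<not> ?A c a' \<and> ?A c b')"
    unfolding contains_Gamma_iff dims
    by (rule iff_exI)+ (use bound in \<open>auto simp: biadjacency_matrix_index simp del: One_nat_def\<close>)
  have D: "contains_pattern ?M Delta_pattern \<longleftrightarrow>
     (\<exists>a b c a' b' c'. a < b \<and> b < c \<and> a' < b' \<and> b' < c' \<and>
        ?A a a' \<and> \<not> ?A b a' \<and> ?A b b' \<and> ?A c a' \<and> \<not> ?A c b' \<and> ?A c c')"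
    unfolding contains_Delta_iff dims
    by (rule iff_exI)+ (use bound in \<open>auto simp: biadjacency_matrix_index simp del: One_nat_def\<close>)
  show ?thesis
    unfolding G D conflict_free_iff ..
qed

subsection \<open>Separating the forced zeros\<close>

text \<open>Delete the vertices 0, 1, 2, ... in turn. A cycle through the smallest remaining vertex
  can bypass it, so a cycle would survive every deletion, although nothing is left after
  \<open>m\<close> of them. The shortcut includes \<open>x = y\<close>, which together with
  irreflexivity rules out cycles of length two.\<close>

lemma acyclic_if_minimal_shortcut:
  fixes r :: "(nat \<times> nat) set"
  assumes bounded: "r \<subseteq> {..<m} \<times> {..<m}"
    and irrefl: "\<And>x. (x, x) \<notin> r"
    and shortcut: "\<And>x y z. z < x \<Longrightarrow> z < y \<Longrightarrow> (x, z) \<in> r \<Longrightarrow> (z, y) \<in> r \<Longrightarrow> (x, y) \<in> r"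
  shows "acyclic r"
proof -
  define R where "R n = r \<inter> {n..} \<times> {n..}" for n
  \<comment> \<open>The induction follows a walk from \<open>x\<close> and reroutes it around
    \<open>n\<close>. While the walk stands at \<open>n\<close>, its last vertex \<open>z\<close>
    before \<open>n\<close> is remembered, so that the next step can start from
    \<open>z\<close>.\<close>
  have skip: "(y > n \<longrightarrow> (x, y) \<in> (R (Suc n))\<^sup>+) \<and>
      (y = n \<longrightarrow> (\<exists>z>n. (z, n) \<in> r \<and> (x, z) \<in> (R (Suc n))\<^sup>*))"
    if "(x, y) \<in> (R n)\<^sup>+" "x > n" for n x y
    using that
  proof (induction rule: trancl_induct)
    case (base y)
    then show ?case by (auto simp: R_def)
  next
    case (step y y')
    have yy': "(y, y') \<in> r" "y \<ge> n" "y' \<ge> n" using step.hyps by (auto simp: R_def)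
    consider "y > n" "y' > n" | "y > n" "y' = n" | "y = n" "y' > n"
      using yy' irrefl by (metis le_neq_implies_less)
    then show ?case
    proof cases
      case 1
      then have "(y, y') \<in> R (Suc n)" using yy' by (auto simp: R_def)
      then show ?thesis using 1 step by (auto intro: trancl_into_trancl)
    next
      case 2
      then show ?thesis using yy' step by (auto intro: trancl_into_rtrancl)
    next
      case 3
      then obtain z where z: "z > n" "(z, n) \<in> r" "(x, z) \<in> (R (Suc n))\<^sup>*"
        using step by auto
      have "(z, y') \<in> R (Suc n)" using shortcut[of n z y'] z 3 yy' by (auto simp: R_def)
      then show ?thesis using z 3 by (auto intro: rtrancl_into_trancl1)
    qed
  qed
  have "\<exists>x. (x, x) \<in> (R n)\<^sup>+" if "\<not> acyclic r" for n
  proof (induction n)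
    case 0
    then show ?case using that by (auto simp: R_def acyclic_def)
  next
    case (Suc n)
    then obtain x where x: "(x, x) \<in> (R n)\<^sup>+" by blast
    \<comment> \<open>A cycle starting at \<open>n\<close> is rotated to start at the successor of
      \<open>n\<close>, which is larger by irreflexivity.\<close>
    have "\<exists>y>n. (y, y) \<in> (R n)\<^sup>+"
    proof (cases "x > n")
      case False
      obtain y where y: "(x, y) \<in> R n" "(y, x) \<in> (R n)\<^sup>*"
        using x by (meson tranclD)
      then have "y > n" using False irrefl[of x] by (cases "y = x") (auto simp: R_def)
      then show ?thesis using y by (meson rtrancl_into_trancl1)
    qed (use x in blast)
    then show ?case using skip by blast
  qed
  moreover have "R m = {}" using bounded by (auto simp: R_def)
  ultimately show ?thesis by (metis empty_iff trancl_empty)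
qed

text \<open>Once the relation \<open>r\<close> on rows is acyclic, counting the ancestors of a row
  gives a function that strictly increases along \<open>r\<close>. It will order the rows for the
  third chain graph.\<close>

lemma conflict_free_separating:
  assumes bounded: "\<And>i j. A i j \<Longrightarrow> i < m"
    and cf: "conflict_free A"
  obtains h :: "nat \<Rightarrow> nat" where "\<And>i i' j. forced_zero A i' j \<Longrightarrow> A i j \<Longrightarrow> h i' < h i"
proof -
  define r where "r = {(i', i). \<exists>j. forced_zero A i' j \<and> A i j}"
  have no_conflict: "False" if "forced_zero A i j" "forced_zero A i' j'" "A i j'" "A i' j" for i j i' j'
    using cf that unfolding conflict_free_def by blast
  have "acyclic r"
  proof (rule acyclic_if_minimal_shortcut)
    show "r \<subseteq> {..<m} \<times> {..<m}"
      using bounded by (auto simp: r_def forced_zero_def)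
    show "(x, x) \<notin> r" for x by (auto simp: r_def forced_zero_def)
    fix x y z assume zx: "z < x" and zy: "z < y" and "(x, z) \<in> r" "(z, y) \<in> r"
    then obtain v w where v: "forced_zero A x v" "A z v" and w: "forced_zero A z w" "A y w"
      by (auto simp: r_def)
    show "(x, y) \<in> r"
    proof (rule ccontr)
      assume *: "(x, y) \<notin> r"
      \<comment> \<open>The entries \<open>(x, w)\<close> and \<open>(y, v)\<close> are zeros with a
        one above them, yet not forced. Hence row \<open>x\<close> has no one to the right of
        \<open>w\<close>, and row \<open>y\<close> none to the right of \<open>v\<close>. The one at
        \<open>(y, w)\<close> then gives \<open>w < v\<close>, while the forced zero
        \<open>(x, v)\<close> has a one further right.\<close>
      have "\<not> A y v" "\<not> forced_zero A x w" using * v w by (auto simp: r_def)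
      moreover have "\<not> A x w" "\<not> forced_zero A y v" using no_conflict v w by blast+
      ultimately have no_right: "\<not> A x j" if "j > w" for j
        using that w zx unfolding forced_zero_def by (meson less_trans)
      have no_right': "\<not> A y j" if "j > v" for j
        using that v zy \<open>\<not> A y v\<close> \<open>\<not> forced_zero A y v\<close> unfolding forced_zero_def by blast
      have "w < v" using no_right' w(2) \<open>\<not> A y v\<close> by (metis linorder_neqE_nat)
      moreover obtain k where "k > v" "A x k" using v(1) by (auto simp: forced_zero_def)
      ultimately show False using no_right by (meson less_trans)
    qed
  qed
  have sub: "r\<^sup>+ \<subseteq> {..<m} \<times> {..<m}"
    using bounded by (intro trancl_subset_Sigma) (auto simp: r_def forced_zero_def)
  define h where "h i = card {k. (k, i) \<in> r\<^sup>+}" for i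
  have "h i' < h i" if "forced_zero A i' j" "A i j" for i i' j
    unfolding h_def
  proof (rule psubset_card_mono)
    show "finite {k. (k, i) \<in> r\<^sup>+}"
      by (rule finite_subset[of _ "{..<m}"]) (use sub in auto)
    have "(i', i) \<in> r" using that by (auto simp: r_def)
    \<comment> \<open>The inclusion is strict because \<open>i'\<close> is an ancestor of
      \<open>i\<close> but, by acyclicity, not of itself.\<close>
    then show "{k. (k, i') \<in> r\<^sup>+} \<subset> {k. (k, i) \<in> r\<^sup>+}"
      using \<open>acyclic r\<close> by (auto simp: acyclic_def intro: trancl_into_trancl)
  qed
  then show thesis by (rule that)
qed

subsection \<open>Chain graphs\<close>

lemma ex_sorted_permutation:
  fixes f :: "'a \<Rightarrow> 'b::linorder"
  assumes "finite U"
  obtains us where "us \<in> permutations_of_set U"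
    and "\<And>i j. i \<le> j \<Longrightarrow> j < length us \<Longrightarrow> f (us ! i) \<le> f (us ! j)"
proof -
  obtain xs where xs: "set xs = U" "distinct xs" using finite_distinct_list[OF assms] by blast
  have "sort_key f xs \<in> permutations_of_set U" using xs by (auto intro: permutations_of_setI)
  moreover have "f (sort_key f xs ! i) \<le> f (sort_key f xs ! j)"
    if "i \<le> j" "j < length (sort_key f xs)" for i j
    using sorted_nth_mono[OF sorted_sort_key, of i j f xs] that by simp
  ultimately show thesis by (rule that)
qed

text \<open>Nesting on one side forces nesting on the other: two incomparable neighbourhoods of
  vertices in \<open>V\<close> would contradict monotonicity along \<open>f\<close>. So only a key
  on \<open>U\<close> has to be supplied.\<close>

lemma chain_graphI:
  fixes f :: "'a \<Rightarrow> 'b::linorder"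
  assumes fin: "finite U" "finite V" and disj: "U \<inter> V = {}"
    and mono: "\<And>u u' v. u \<in> U \<Longrightarrow> u' \<in> U \<Longrightarrow> v \<in> V \<Longrightarrow> f u \<le> f u' \<Longrightarrow> P u v \<Longrightarrow> P u' v"
  shows "chain_graph U V {{u, v} | u v. u \<in> U \<and> v \<in> V \<and> P u v}" (is "chain_graph U V ?E")
proof -
  have NU: "neighbourhood ?E u = {v \<in> V. P u v}" if "u \<in> U" for u
    using that disj by (auto simp: neighbourhood_def doubleton_eq_iff)
  have NV: "neighbourhood ?E v = {u \<in> U. P u v}" if "v \<in> V" for v
    using that disj by (auto simp: neighbourhood_def doubleton_eq_iff)
  obtain us where us: "us \<in> permutations_of_set U"
    "\<And>i j. i \<le> j \<Longrightarrow> j < length us \<Longrightarrow> f (us ! i) \<le> f (us ! j)"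
    using ex_sorted_permutation[OF fin(1)] by blast
  have "neighbourhood ?E (us ! i) \<subseteq> neighbourhood ?E (us ! j)"
    if ij: "i \<le> j" "j < length us" for i j
  proof -
    have "us ! i \<in> U" "us ! j \<in> U"
      using ij permutations_of_setD(1)[OF us(1)] by auto
    then show ?thesis using mono us(2)[OF ij] by (auto simp: NU)
  qed
  moreover
  \<comment> \<open>\<open>V\<close> is ordered by degree; comparable finite sets are included
    according to their cardinalities.\<close>
  obtain vs where vs: "vs \<in> permutations_of_set V"
    "\<And>i j. i \<le> j \<Longrightarrow> j < length vs \<Longrightarrow> card {u \<in> U. P u (vs ! i)} \<le> card {u \<in> U. P u (vs ! j)}"
    using ex_sorted_permutation[OF fin(2), of "\<lambda>v. card {u \<in> U. P u v}"] by blast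
  have "neighbourhood ?E (vs ! i) \<subseteq> neighbourhood ?E (vs ! j)"
    if ij: "i \<le> j" "j < length vs" for i j
  proof -
    have V: "vs ! i \<in> V" "vs ! j \<in> V"
      using ij permutations_of_setD(1)[OF vs(1)] by auto
    have "{u \<in> U. P u (vs ! i)} \<subseteq> {u \<in> U. P u (vs ! j)} \<or>
          {u \<in> U. P u (vs ! j)} \<subseteq> {u \<in> U. P u (vs ! i)}"
    proof (rule ccontr)
      assume "\<not> ?thesis"
      then obtain a b where "a \<in> U" "b \<in> U" "P a (vs ! i)" "\<not> P a (vs ! j)"
        "P b (vs ! j)" "\<not> P b (vs ! i)" by blast
      then show False using mono V by (metis linorder_le_cases)
    qed
    moreover have "finite {u \<in> U. P u (vs ! i)}" using fin(1) by simp
    ultimately have "{u \<in> U. P u (vs ! i)} \<subseteq> {u \<in> U. P u (vs ! j)}"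
      using vs(2)[OF ij] card_seteq by blast
    then show ?thesis using V by (simp add: NV)
  qed
  moreover have "bipartite_graph U V ?E"
    using fin disj by (auto simp: bipartite_graph_def)
  ultimately show ?thesis
    unfolding chain_graph_def using us(1) vs(1) by blast
qed

lemma bipartite_graph_sym:
  assumes "bipartite_graph U V E"
  shows "bipartite_graph V U E"
proof -
  have "\<exists>v\<in>V. \<exists>u\<in>U. e = {v, u}" if "e \<in> E" for e
  proof -
    have "\<exists>u\<in>U. \<exists>v\<in>V. e = {u, v}"
      using assms that unfolding bipartite_graph_def by (elim conjE) (erule (1) bspec)
    then obtain u v where "u \<in> U" "v \<in> V" "e = {u, v}" by blast
    then show ?thesis by (intro bexI[of _ v] bexI[of _ u]) (simp_all add: insert_commute)
  qed
  then show ?thesis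
    using assms by (simp add: bipartite_graph_def Int_commute)
qed

lemma chain_graph_sym: "chain_graph U V E \<Longrightarrow> chain_graph V U E"
  unfolding chain_graph_def
  by (elim conjE, intro conjI, erule bipartite_graph_sym, assumption+)

lemma chain_graph_nestedE:
  assumes "chain_graph U V E"
  obtains us where "us \<in> permutations_of_set U"
    and "\<And>i j. i \<le> j \<Longrightarrow> j < length us \<Longrightarrow> neighbourhood E (us ! i) \<subseteq> neighbourhood E (us ! j)"
proof -
  have "\<exists>us \<in> permutations_of_set U. \<forall>i j. i \<le> j \<longrightarrow> j < length us \<longrightarrow>
      neighbourhood E (us ! i) \<subseteq> neighbourhood E (us ! j)"
    using assms unfolding chain_graph_def by (elim conjE)
  then show thesis using that by (elim bexE) simp
qed

text \<open>The neighbourhoods of \<open>u\<close> and \<open>u'\<close> are comparable, and the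
  larger one contains both \<open>v\<close> and \<open>v'\<close>.\<close>

lemma chain_graph_no_2K2:
  assumes "chain_graph U V E" "u \<in> U" "u' \<in> U" "{u, v} \<in> E" "{u', v'} \<in> E"
  shows "{u, v'} \<in> E \<or> {u', v} \<in> E"
proof -
  obtain us where us: "us \<in> permutations_of_set U"
    "\<And>i j. i \<le> j \<Longrightarrow> j < length us \<Longrightarrow> neighbourhood E (us ! i) \<subseteq> neighbourhood E (us ! j)"
    using chain_graph_nestedE[OF assms(1)] by blast
  obtain i j where "i < length us" "us ! i = u" "j < length us" "us ! j = u'"
    using assms(2,3) permutations_of_setD(1)[OF us(1)] by (metis in_set_conv_nth)
  then have "neighbourhood E u \<subseteq> neighbourhood E u' \<or> neighbourhood E u' \<subseteq> neighbourhood E u"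
    using us(2) by (metis nat_le_linear)
  then show ?thesis using assms(4,5) by (auto simp: neighbourhood_def)
qed

section \<open>Ferrers dimension as an attained minimum\<close>

lemma complete_chain_graph:
  assumes "finite U" "finite V" "U \<inter> V = {}"
  shows "chain_graph U V {{u, v} | u v. u \<in> U \<and> v \<in> V}"
  using chain_graphI[OF assms, of "\<lambda>_. 0::nat" "\<lambda>_ _. True"] by simp

text \<open>Only the neighbourhood of \<open>a\<close> can shrink, so the key puts \<open>a\<close>
  first and treats all other vertices alike.\<close>

lemma complete_minus_edge_chain_graph:
  assumes "finite U" "finite V" "U \<inter> V = {}"
  shows "chain_graph U V {{u, v} | u v. u \<in> U \<and> v \<in> V \<and> (u, v) \<noteq> (a, b)}"
  by (rule chain_graphI[OF assms, of "\<lambda>u. if u = a then 0 else 1::nat"]) (auto split: if_splits)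

text \<open>This makes the \<open>LEAST\<close> in \<open>ferrers_dimension\<close> meaningful: any
  graph arises from the complete bipartite graph by removing its non-edges, one chain graph for
  each.\<close>

lemma ex_chain_graph_intersection:
  assumes "bipartite_graph U V E"
  shows "\<exists>d::nat. d \<ge> 1 \<and> (\<exists>F. (\<forall>i<d. chain_graph U V (F i)) \<and> E = (\<Inter>i<d. F i))"
proof -
  have fin: "finite U" "finite V" "U \<inter> V = {}" and
    E: "\<And>e. e \<in> E \<Longrightarrow> \<exists>u\<in>U. \<exists>v\<in>V. e = {u, v}"
    using assms by (auto simp: bipartite_graph_def)
  let ?K = "{{u, v} | u v. u \<in> U \<and> v \<in> V}"
  let ?C = "\<lambda>p. {{u, v} | u v. u \<in> U \<and> v \<in> V \<and> (u, v) \<noteq> p}"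
  let ?N = "{p \<in> U \<times> V. {fst p, snd p} \<notin> E}"
  have "finite ?N" using fin by simp
  then obtain ps where ps: "set ps = ?N" using finite_list by blast
  \<comment> \<open>Index 0 holds the complete graph, so the family is nonempty even if there are no
    non-edges; the non-edges are shifted by one.\<close>
  define F where "F i = (if i = 0 then ?K else ?C (ps ! (i - 1)))" for i :: nat
  have "chain_graph U V (F i)" for i
    using complete_chain_graph[OF fin] complete_minus_edge_chain_graph[OF fin]
    by (cases "ps ! (i - 1)") (simp add: F_def)
  moreover have "(\<Inter>i<Suc (length ps). F i) = ?K \<inter> (\<Inter>p\<in>?N. ?C p)"
  proof -
    have N: "?N = (!) ps ` {..<length ps}"
      unfolding ps[symmetric] by (auto simp: set_conv_nth)
    show ?thesis
      unfolding N lessThan_Suc_eq_insert_0 INT_insert image_image INT_simps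
      by (simp only: F_def image_image nat.simps diff_Suc_1 refl if_True if_False)
  qed
  moreover have "E = ?K \<inter> (\<Inter>p\<in>?N. ?C p)"
  proof (intro equalityI subsetI)
    fix e assume e: "e \<in> E"
    then obtain u v where uv: "u \<in> U" "v \<in> V" "e = {u, v}" using E by blast
    then show "e \<in> ?K \<inter> (\<Inter>p\<in>?N. ?C p)" using e by fastforce
  next
    fix e assume e: "e \<in> ?K \<inter> (\<Inter>p\<in>?N. ?C p)"
    then obtain u v where uv: "u \<in> U" "v \<in> V" "e = {u, v}" by blast
    show "e \<in> E"
    proof (rule ccontr)
      assume "e \<notin> E"
      then have "e \<in> ?C (u, v)" using e uv by auto
      then show False using uv fin(3) by (auto simp: doubleton_eq_iff)
    qed
  qed
  ultimately have "(\<forall>i<Suc (length ps). chain_graph U V (F i)) \<and> E = (\<Inter>i<Suc (length ps). F i)"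
    by simp
  then show ?thesis by (intro exI[of _ "Suc (length ps)"] conjI exI[of _ F]) simp_all
qed

lemma ferrers_dimension_le_3_iff:
  assumes "bipartite_graph U V E"
  shows "ferrers_dimension U V E \<le> 3 \<longleftrightarrow>
    (\<exists>E1 E2 E3. chain_graph U V E1 \<and> chain_graph U V E2 \<and> chain_graph U V E3 \<and>
       E = E1 \<inter> E2 \<inter> E3)" (is "_ \<longleftrightarrow> ?R")
proof
  assume le: "ferrers_dimension U V E \<le> 3"
  define d where "d = ferrers_dimension U V E"
  have d: "d \<ge> 1 \<and> (\<exists>F. (\<forall>i<d. chain_graph U V (F i)) \<and> E = (\<Inter>i<d. F i))"
    unfolding d_def ferrers_dimension_def
    using ex_chain_graph_intersection[OF assms] by (rule LeastI_ex)
  then obtain F where F: "\<forall>i<d. chain_graph U V (F i)" "E = (\<Inter>i<d. F i)"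
    by blast
  have d: "d \<ge> 1" "d \<le> 3" using d le by (simp_all add: d_def)
  \<comment> \<open>If the minimum is 1 or 2, the last chain graph is repeated to make
    three.\<close>
  define G where "G i = F (min i (d - 1))" for i
  have "chain_graph U V (G i)" for i using d F(1) by (auto simp: G_def)
  moreover have "{..<d} = {min 0 (d - 1), min 1 (d - 1), min 2 (d - 1)}"
    using d by auto
  then have "E = G 0 \<inter> G 1 \<inter> G 2" unfolding F(2) G_def by auto
  ultimately show ?R by blast
next
  assume ?R
  then obtain E1 E2 E3 where E: "chain_graph U V E1" "chain_graph U V E2" "chain_graph U V E3"
    "E = E1 \<inter> E2 \<inter> E3" by blast
  have "{..<3::nat} = {0, 1, 2}" by auto
  then have "E = (\<Inter>i<3. [E1, E2, E3] ! i)" using E(4) by (simp add: Int_assoc)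
  moreover have "\<forall>i<3. chain_graph U V ([E1, E2, E3] ! i)"
    using E(1-3) by (simp add: All_less_three)
  ultimately have "(3::nat) \<ge> 1 \<and>
      (\<exists>F. (\<forall>i<(3::nat). chain_graph U V (F i)) \<and> E = (\<Inter>i<(3::nat). F i))"
    by (intro conjI exI[of _ "(!) [E1, E2, E3]"]) simp_all
  then show "ferrers_dimension U V E \<le> 3"
    unfolding ferrers_dimension_def by (rule Least_le)
qed

section \<open>The two directions of the equivalence\<close>

lemma chain_graphs_conflict_free:
  assumes chain: "chain_graph U V E1" "chain_graph U V E2" "chain_graph U V E3"
    and E: "E = E1 \<inter> E2 \<inter> E3"
  shows "\<exists>us \<in> permutations_of_set U. \<exists>vs \<in> permutations_of_set V.
    conflict_free (bip_entry E us vs)"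
proof -
  obtain us where us: "us \<in> permutations_of_set U"
    "\<And>i j. i \<le> j \<Longrightarrow> j < length us \<Longrightarrow> neighbourhood E1 (us ! i) \<subseteq> neighbourhood E1 (us ! j)"
    using chain_graph_nestedE[OF chain(1)] by blast
  obtain ws where ws: "ws \<in> permutations_of_set V"
    "\<And>i j. i \<le> j \<Longrightarrow> j < length ws \<Longrightarrow> neighbourhood E2 (ws ! i) \<subseteq> neighbourhood E2 (ws ! j)"
    using chain_graph_nestedE[OF chain_graph_sym[OF chain(2)]] by blast
  \<comment> \<open>Columns are listed with decreasing neighbourhoods in \<open>E2\<close>, so that
    its edges propagate to the left, whereas those of \<open>E1\<close> propagate downwards.\<close>
  define vs where "vs = rev ws"
  have vs: "vs \<in> permutations_of_set V" using permutations_of_setD[OF ws(1)] by (auto simp: vs_def)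
  have nbh: "neighbourhood E2 (vs ! j) \<subseteq> neighbourhood E2 (vs ! i)"
    if "i \<le> j" "j < length vs" for i j
    using ws(2)[of "length ws - Suc j" "length ws - Suc i"] that by (simp add: vs_def rev_nth)
  let ?A = "bip_entry E us vs"
  \<comment> \<open>The one above puts the pair into \<open>E1\<close> and the one to the right puts
    it into \<open>E2\<close>, so only \<open>E3\<close> can omit it.\<close>
  have forced: "{us ! i, vs ! j} \<notin> E3"
    if F: "forced_zero ?A i j" for i j
  proof -
    obtain i' j' where *: "i' < i" "?A i' j" "j' > j" "?A i j'" "\<not> ?A i j"
      using F by (auto simp: forced_zero_def)
    then have lt: "i < length us" "j < length vs" "j' < length vs" by (auto simp: bip_entry_def)
    have "vs ! j \<in> neighbourhood E1 (us ! i')" "us ! i \<in> neighbourhood E2 (vs ! j')"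
      using * E by (simp_all add: bip_entry_def neighbourhood_def insert_commute)
    moreover have "neighbourhood E1 (us ! i') \<subseteq> neighbourhood E1 (us ! i)"
      "neighbourhood E2 (vs ! j') \<subseteq> neighbourhood E2 (vs ! j)"
      using us(2)[of i' i] nbh[of j j'] * lt by simp_all
    ultimately have "vs ! j \<in> neighbourhood E1 (us ! i)" "us ! i \<in> neighbourhood E2 (vs ! j)"
      by blast+
    then have "{us ! i, vs ! j} \<in> E1" "{us ! i, vs ! j} \<in> E2"
      by (simp_all add: neighbourhood_def insert_commute)
    then show ?thesis using * lt E by (auto simp: bip_entry_def)
  qed
  have "conflict_free ?A"
    unfolding conflict_free_def
  proof (intro notI, elim exE conjE)
    fix i j i' j'
    assume F: "forced_zero ?A i j" "forced_zero ?A i' j'" and A: "?A i j'" "?A i' j"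
    have "us ! i \<in> U" "us ! i' \<in> U"
      using A permutations_of_setD(1)[OF us(1)] by (auto simp: bip_entry_def)
    moreover have "{us ! i, vs ! j'} \<in> E3" "{us ! i', vs ! j} \<in> E3"
      using A E by (auto simp: bip_entry_def)
    ultimately show False
      using chain_graph_no_2K2[OF chain(3)] forced F by blast
  qed
  then show ?thesis using us(1) vs by blast
qed

lemma ex_position:
  assumes "us \<in> permutations_of_set U"
  obtains p where "bij_betw p U {..<length us}" "\<And>u. u \<in> U \<Longrightarrow> us ! p u = u"
proof -
  have b: "bij_betw ((!) us) {..<length us} U"
    using permutations_of_setD[OF assms] by (intro bij_betw_nth) auto
  show thesis
    by (rule that[OF bij_betw_the_inv_into[OF b]])
      (use b in \<open>auto simp: bij_betw_def f_the_inv_into_f\<close>)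
qed

text \<open>\<open>P1\<close> closes the ones downwards and \<open>P2\<close> closes them to the
  left. \<open>P3\<close> admits a row in a given column if its \<open>h\<close> value exceeds that
  of every row with a forced zero there, a threshold condition and hence a chain graph.\<close>

lemma conflict_free_chain_graphs:
  assumes G: "bipartite_graph U V E"
    and us: "us \<in> permutations_of_set U" and vs: "vs \<in> permutations_of_set V"
    and cf: "conflict_free (bip_entry E us vs)"
  shows "\<exists>E1 E2 E3. chain_graph U V E1 \<and> chain_graph U V E2 \<and> chain_graph U V E3 \<and>
    E = E1 \<inter> E2 \<inter> E3"
proof -
  have fin: "finite U" "finite V" "U \<inter> V = {}" "V \<inter> U = {}" and
    E: "\<And>e. e \<in> E \<Longrightarrow> \<exists>u\<in>U. \<exists>v\<in>V. e = {u, v}"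
    using G by (auto simp: bipartite_graph_def)
  let ?A = "bip_entry E us vs"
  obtain p where p: "bij_betw p U {..<length us}" "\<And>u. u \<in> U \<Longrightarrow> us ! p u = u"
    using ex_position[OF us] by blast
  obtain q where q: "bij_betw q V {..<length vs}" "\<And>v. v \<in> V \<Longrightarrow> vs ! q v = v"
    using ex_position[OF vs] by blast
  have A: "?A (p u) (q v) \<longleftrightarrow> {u, v} \<in> E" if "u \<in> U" "v \<in> V" for u v
    using that p q by (auto simp: bip_entry_def bij_betw_def)
  obtain h :: "nat \<Rightarrow> nat" where h: "\<And>i i' j. forced_zero ?A i' j \<Longrightarrow> ?A i j \<Longrightarrow> h i' < h i"
    using conflict_free_separating[OF _ cf, of "length us"] by (auto simp: bip_entry_def)
  define P1 where "P1 u v \<longleftrightarrow> (\<exists>i\<le>p u. ?A i (q v))" for u v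
  define P2 where "P2 u v \<longleftrightarrow> (\<exists>j\<ge>q v. ?A (p u) j)" for u v
  define P3 where "P3 u v \<longleftrightarrow> (\<forall>i. forced_zero ?A i (q v) \<longrightarrow> h i < h (p u))" for u v
  let ?E = "\<lambda>P. {{u, v} | u v. u \<in> U \<and> v \<in> V \<and> P u v}"
  have "chain_graph U V (?E P1)"
    by (rule chain_graphI[OF fin(1-3), of p]) (auto simp: P1_def intro: order_trans)
  \<comment> \<open>Here the columns carry the key, so the sides are exchanged; the sign is negative
    because columns further left have larger neighbourhoods.\<close>
  moreover have "chain_graph V U {{v, u} | v u. v \<in> V \<and> u \<in> U \<and> P2 u v}"
    by (rule chain_graphI[OF fin(2,1,4), of "\<lambda>v. - int (q v)"]) (auto simp: P2_def intro: order_trans)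
  then have "chain_graph V U (?E P2)"
    by (rule back_subst) (auto simp: insert_commute)
  then have "chain_graph U V (?E P2)" by (rule chain_graph_sym)
  moreover have "chain_graph U V (?E P3)"
    by (rule chain_graphI[OF fin(1-3), of "\<lambda>u. h (p u)"])
      (auto simp: P3_def intro: less_le_trans)
  moreover have "E = ?E P1 \<inter> ?E P2 \<inter> ?E P3"
  proof -
    have all: "P1 u v \<and> P2 u v \<and> P3 u v \<longleftrightarrow> {u, v} \<in> E" if "u \<in> U" "v \<in> V" for u v
    proof
      assume "P1 u v \<and> P2 u v \<and> P3 u v"
      \<comment> \<open>A zero satisfying \<open>P1\<close> and \<open>P2\<close> has ones above and
        to the right, so it is forced, and \<open>P3\<close> would give
        \<open>h (p u) < h (p u)\<close>.\<close>
      then have "?A (p u) (q v)"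
        unfolding P1_def P2_def P3_def forced_zero_def by (metis le_neq_implies_less less_irrefl)
      then show "{u, v} \<in> E" using A that by simp
    next
      assume "{u, v} \<in> E"
      then show "P1 u v \<and> P2 u v \<and> P3 u v"
        unfolding P1_def P2_def P3_def using A[OF that] h by blast
    qed
    have mem: "{u, v} \<in> ?E P \<longleftrightarrow> P u v" if "u \<in> U" "v \<in> V" for u v P
      using that fin(3) by (auto simp: doubleton_eq_iff)
    have "e \<in> E \<longleftrightarrow> e \<in> ?E P1 \<inter> ?E P2 \<inter> ?E P3" for e
    proof (cases "\<exists>u\<in>U. \<exists>v\<in>V. e = {u, v}")
      case True
      then obtain u v where uv: "u \<in> U" "v \<in> V" and e: "e = {u, v}" by blast
      show ?thesis unfolding e Int_iff mem[OF uv] using all[OF uv] by simp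
    next
      case False
      then show ?thesis using E by blast
    qed
    then show ?thesis by blast
  qed
  ultimately show ?thesis by blast
qed

theorem theorem1:
  fixes U V :: "'a set" and E :: "'a set set"
  assumes "bipartite_graph U V E"
  shows "((\<exists>E1 E2 E3. chain_graph U V E1 \<and> chain_graph U V E2 \<and> chain_graph U V E3 \<and>
             E = E1 \<inter> E2 \<inter> E3) \<longleftrightarrow>
          (\<exists>us \<in> permutations_of_set U. \<exists>vs \<in> permutations_of_set V.
             \<not> contains_pattern (biadjacency_matrix E us vs) Gamma_pattern \<and>
             \<not> contains_pattern (biadjacency_matrix E us vs) Delta_pattern)) \<and>
         (ferrers_dimension U V E \<le> 3 \<longleftrightarrow>
          (\<exists>us \<in> permutations_of_set U. \<exists>vs \<in> permutations_of_set V.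
             \<not> contains_pattern (biadjacency_matrix E us vs) Gamma_pattern \<and>
             \<not> contains_pattern (biadjacency_matrix E us vs) Delta_pattern))"
  \<comment> \<open>Both conjuncts become the same equivalence between three chain graphs and a
    conflict-free pair of orderings.\<close>
  unfolding ferrers_dimension_le_3_iff[OF assms] avoids_patterns_iff_conflict_free
  using chain_graphs_conflict_free[of U V _ _ _ E] conflict_free_chain_graphs[OF assms] by blast

end
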